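(* Suppose Assumptions 1, 2 and 3 (stated in the context) hold. Consider the differentiated projected algorithm $$\dot{x}_i = \Pi_{\Omega_i}\big(x_i,\,-\nabla f_i(x_i)+\lambda_i\big),$$ $$\dot{\lambda}_i = -\sum_{j\in\mathcal{N}_i}(\lambda_i-\lambda_j)-\sum_{j\in\mathcal{N}_i}(z_i-z_j)+(d_i-x_i),$$ $$\dot{z}_i = \sum_{j\in\mathcal{N}_i}(\lambda_i-\lambda_j),\qquad i\in\mathcal{N}.$$ If $x_i(0)\in\Omega_i$ for all $i\in\mathcal{N}$, then $x_i(t)\in\Omega_i$ for all $t\ge 0$ and all $i\in\mathcal{N}$. Moreover, there is an equilibrium point $(X^*,\Lambda^*,Z^* )$ of the algorithm such that $X^*=(x_1^*,\dots,x_n^* )$ is the optimal solution of $$\min_{x_1,\dots,x_n\in\mathbf{R}^m}\ \sum_{i\in\mathcal{N}} f_i(x_i)\quad\text{subject to}\quad \sum_{i\in\mathcal{N}}x_i=\sum_{i\in\mathcal{N}}d_i,\quad x_i\in\Omega_i,\ i\in\mathcal{N}.$$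
   Context: Let $\mathcal{N}=\{1,\dots,n\}$ be a set of agents. For each $i\in\mathcal{N}$, $\Omega_i\subset\mathbf{R}^m$ is a closed convex set, $d_i\in\mathbf{R}^m$ is a given vector (local resource), and $f_i:\mathbf{R}^m\to\mathbf{R}$ is a local objective function. The resource allocation problem is to minimize $\sum_{i} f_i(x_i)$ over $x_1,\dots,x_n\in\mathbf{R}^m$ subject to $\sum_i x_i=\sum_i d_i$ and $x_i\in\Omega_i$ for all $i$. $P_{\Omega}(x)=\arg\min_{y\in\Omega}\|x-y\|$ denotes the Euclidean projection onto a closed convex set $\Omega$. For a closed convex set $\Omega$, $x\in\Omega$ and a direction $v$, the differentiated projection operator is $$\Pi_{\Omega}(x,v)=\lim_{\delta\to 0^+}\frac{P_{\Omega}(x+\delta v)-x}{\delta},$$ which equals the projection of $v$ onto the tangent cone of $\Omega$ at $x$. $\mathcal{G}=(\mathcal{N},\mathcal{E})$ is the communication graph, and $\mathcal{N}_i=\{j : (j,i)\in\mathcal{E}\}$ is the neighbor set of agent $i$. The state variables are $x_i\in\Omega_i$, $\lambda_i,z_i\in\mathbf{R}^m$ for $i\in\mathcal{N}$. The right-hand side is discontinuous, and solutions are understood in the Caratheodory sense: absolutely continuous functions of $t$ satisfying the differential equations for almost all $t\ge0$. An equilibrium point is a point $(X^*,\Lambda^*,Z^* )$ with $x_i^*\in\Omega_i$ for all $i$ at which the right-hand sides of all the differential equations vanish, where $X^*,\Lambda^*,Z^*$ collect the components $x_i^*,\lambda_i^*,z_i^*$. Assumption 1: the functions $f_i$, $i\in\mathcal{N}$,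 are continuously differentiable convex functions with locally Lipschitz continuous gradients and with positive definite Hessians over $\mathbf{R}^m$. Assumption 2: there exists a finite optimal solution $X^*$ to the resource allocation problem, and Slater's condition holds: there exist $\tilde{x}_i\in \mathrm{int}(\Omega_i)$, $i\in\mathcal{N}$, with $\sum_{i}\tilde{x}_i=\sum_i d_i$. Assumption 3: the graph $\mathcal{G}$ is undirected and connected. *)

theory Defs
  imports "HOL-Analysis.Analysis" "Graph_Theory.Graph_Theory"
begin

text \<open>
  The agents are the elements of a finite type \<open>'n\<close> and the local decision space is
  \<open>real ^ 'm\<close>. Families indexed by the agents are functions on \<open>'n\<close>.
\<close>

definition gradient :: "('a::real_inner \<Rightarrow> real) \<Rightarrow> 'a \<Rightarrow> 'a" where
  "gradient f x = (THE D. GDERIV f x :> D)"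

definition positive_definite :: "real ^ 'm ^ 'm \<Rightarrow> bool" where
  "positive_definite H \<longleftrightarrow> transpose H = H \<and> (\<forall>h. h \<noteq> 0 \<longrightarrow> h \<bullet> (H *v h) > 0)"

definition has_hessian :: "(real ^ 'm \<Rightarrow> real) \<Rightarrow> real ^ 'm ^ 'm \<Rightarrow> real ^ 'm \<Rightarrow> bool" where
  "has_hessian f H x \<longleftrightarrow> (gradient f has_derivative (\<lambda>h. H *v h)) (at x)"

text \<open>
  The first argument of \<^const>\<open>local_lipschitz\<close> is a time domain, on which the gradient does not
  depend.
\<close>

definition smooth_convex_objective :: "(real ^ 'm \<Rightarrow> real) \<Rightarrow> bool" where
  "smooth_convex_objective f \<longleftrightarrow>
     convex_on UNIV f \<and>
     (\<forall>x. f differentiable (at x)) \<and>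
     continuous_on UNIV (gradient f) \<and>
     local_lipschitz (UNIV :: real set) UNIV (\<lambda>_. gradient f) \<and>
     (\<forall>x. \<exists>H. has_hessian f H x \<and> positive_definite H)"

definition feasible ::
  "('n::finite \<Rightarrow> (real ^ 'm) set) \<Rightarrow> ('n \<Rightarrow> real ^ 'm) \<Rightarrow> ('n \<Rightarrow> real ^ 'm) \<Rightarrow> bool" where
  "feasible \<Omega> d X \<longleftrightarrow> (\<Sum>i\<in>UNIV. X i) = (\<Sum>i\<in>UNIV. d i) \<and> (\<forall>i. X i \<in> \<Omega> i)"

definition optimal_solution ::
  "('n::finite \<Rightarrow> real ^ 'm \<Rightarrow> real) \<Rightarrow> ('n \<Rightarrow> (real ^ 'm) set) \<Rightarrow> ('n \<Rightarrow> real ^ 'm) \<Rightarrow>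
   ('n \<Rightarrow> real ^ 'm) \<Rightarrow> bool" where
  "optimal_solution f \<Omega> d X \<longleftrightarrow> is_arg_min (\<lambda>Y. \<Sum>i\<in>UNIV. f i (Y i)) (feasible \<Omega> d) X"

definition slater_condition ::
  "('n::finite \<Rightarrow> (real ^ 'm) set) \<Rightarrow> ('n \<Rightarrow> real ^ 'm) \<Rightarrow> bool" where
  "slater_condition \<Omega> d \<longleftrightarrow>
     (\<exists>Y. (\<forall>i. Y i \<in> interior (\<Omega> i)) \<and> (\<Sum>i\<in>UNIV. Y i) = (\<Sum>i\<in>UNIV. d i))"

text \<open>
  An undirected graph is a symmetric digraph; self-loops are not excluded, since they do not
  contribute to the dynamics.
\<close>

definition undirected_connected_graph :: "'n pair_pre_digraph \<Rightarrow> bool" where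
  "undirected_connected_graph G \<longleftrightarrow>
     pverts G = UNIV \<and> pair_sym_digraph G \<and> Digraph_Component.connected (with_proj G)"

definition neighbors :: "'n pair_pre_digraph \<Rightarrow> 'n \<Rightarrow> 'n set" where
  "neighbors G i = {j. (j, i) \<in> parcs G}"

text \<open>
  \<open>has_diff_proj \<Omega> x v w\<close> says that the limit defining \<open>\<Pi>\<^sub>\<Omega>(x, v)\<close> exists and equals \<open>w\<close>.
  It is a relation rather than a total function because \<open>\<Pi>\<^sub>\<Omega>(x, v)\<close> is defined only for
  \<open>x \<in> \<Omega>\<close>: for a nonempty closed \<open>\<Omega>\<close> and \<open>x \<notin> \<Omega>\<close> the difference quotient diverges, and a
  totalized limit would give the differential equation a spurious right-hand side there.
\<close>

definition has_diff_proj ::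
  "'a::euclidean_space set \<Rightarrow> 'a \<Rightarrow> 'a \<Rightarrow> 'a \<Rightarrow> bool" where
  "has_diff_proj \<Omega> x v w \<longleftrightarrow>
     ((\<lambda>\<delta>. (closest_point \<Omega> (x + \<delta> *\<^sub>R v) - x) /\<^sub>R \<delta>) \<longlongrightarrow> w) (at_right 0)"

text \<open>
  \<open>is_rhs f \<Omega> d G x \<lambda> z x' \<lambda>' z'\<close>: at the state \<open>(x, \<lambda>, z)\<close> the right-hand sides of the
  differentiated projected algorithm are defined and have the values \<open>(x', \<lambda>', z')\<close>.
\<close>

definition is_rhs ::
  "('n::finite \<Rightarrow> real ^ 'm \<Rightarrow> real) \<Rightarrow> ('n \<Rightarrow> (real ^ 'm) set) \<Rightarrow> ('n \<Rightarrow> real ^ 'm) \<Rightarrow>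
   'n pair_pre_digraph \<Rightarrow>
   ('n \<Rightarrow> real ^ 'm) \<Rightarrow> ('n \<Rightarrow> real ^ 'm) \<Rightarrow> ('n \<Rightarrow> real ^ 'm) \<Rightarrow>
   ('n \<Rightarrow> real ^ 'm) \<Rightarrow> ('n \<Rightarrow> real ^ 'm) \<Rightarrow> ('n \<Rightarrow> real ^ 'm) \<Rightarrow> bool" where
  "is_rhs f \<Omega> d G x l z x' l' z' \<longleftrightarrow> (\<forall>i.
     has_diff_proj (\<Omega> i) (x i) (- gradient (f i) (x i) + l i) (x' i) \<and>
     l' i = - (\<Sum>j\<in>neighbors G i. l i - l j) - (\<Sum>j\<in>neighbors G i. z i - z j) + (d i - x i) \<and>
     z' i = (\<Sum>j\<in>neighbors G i. l i - l j))"

definition equilibrium_point ::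
  "('n::finite \<Rightarrow> real ^ 'm \<Rightarrow> real) \<Rightarrow> ('n \<Rightarrow> (real ^ 'm) set) \<Rightarrow> ('n \<Rightarrow> real ^ 'm) \<Rightarrow>
   'n pair_pre_digraph \<Rightarrow>
   ('n \<Rightarrow> real ^ 'm) \<Rightarrow> ('n \<Rightarrow> real ^ 'm) \<Rightarrow> ('n \<Rightarrow> real ^ 'm) \<Rightarrow> bool" where
  "equilibrium_point f \<Omega> d G x l z \<longleftrightarrow>
     (\<forall>i. x i \<in> \<Omega> i) \<and> is_rhs f \<Omega> d G x l z (\<lambda>_. 0) (\<lambda>_. 0) (\<lambda>_. 0)"

text \<open>
  Absolute continuity of a function on an interval; the elements \<open>(a, b)\<close> of \<open>D\<close> encode
  non-overlapping compact subintervals.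
\<close>

definition abs_continuous_on :: "real set \<Rightarrow> (real \<Rightarrow> 'a::metric_space) \<Rightarrow> bool" where
  "abs_continuous_on S u \<longleftrightarrow> (\<forall>\<epsilon>>0. \<exists>\<delta>>0. \<forall>D :: (real \<times> real) set.
     finite D \<and> (\<forall>(a, b)\<in>D. a < b \<and> {a..b} \<subseteq> S) \<and>
     pairwise (\<lambda>(a, b) (a', b'). {a<..<b} \<inter> {a'<..<b'} = {}) D \<and>
     (\<Sum>(a, b)\<in>D. b - a) < \<delta>
     \<longrightarrow> (\<Sum>(a, b)\<in>D. dist (u a) (u b)) < \<epsilon>)"

text \<open>
  Caratheodory solutions on the half-line: absolutely continuous on every compact interval
  \<open>[0, T]\<close>, and satisfying the differential equations at almost every \<open>t \<ge> 0\<close>. Membership of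
  \<open>x i t\<close> in \<open>\<Omega> i\<close> is not required separately.
\<close>

definition caratheodory_solution ::
  "('n::finite \<Rightarrow> real ^ 'm \<Rightarrow> real) \<Rightarrow> ('n \<Rightarrow> (real ^ 'm) set) \<Rightarrow> ('n \<Rightarrow> real ^ 'm) \<Rightarrow>
   'n pair_pre_digraph \<Rightarrow>
   ('n \<Rightarrow> real \<Rightarrow> real ^ 'm) \<Rightarrow> ('n \<Rightarrow> real \<Rightarrow> real ^ 'm) \<Rightarrow> ('n \<Rightarrow> real \<Rightarrow> real ^ 'm) \<Rightarrow> bool"
  where
  "caratheodory_solution f \<Omega> d G x l z \<longleftrightarrow>
     (\<forall>i. \<forall>T\<ge>0. abs_continuous_on {0..T} (x i) \<and> abs_continuous_on {0..T} (l i) \<and>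
                 abs_continuous_on {0..T} (z i)) \<and>
     (AE t in lebesgue. 0 \<le> t \<longrightarrow> (\<exists>x' l' z'.
        (\<forall>i. (x i has_vector_derivative x' i) (at t within {0..}) \<and>
             (l i has_vector_derivative l' i) (at t within {0..}) \<and>
             (z i has_vector_derivative z' i) (at t within {0..})) \<and>
        is_rhs f \<Omega> d G (\<lambda>i. x i t) (\<lambda>i. l i t) (\<lambda>i. z i t) x' l' z'))"

end

theory Submission
  imports Defs
begin

text \<open>
  Invariance needs no differential inequality. The quotient that defines the differentiated
  projection at \<open>x\<close> can converge only if \<open>x\<close> is its own projection, so along a Caratheodory
  solution \<open>x\<^sub>i(t) \<in> \<Omega>\<^sub>i\<close> for almost every \<open>t \<ge> 0\<close>. The trajectory is continuous and \<open>\<Omega>\<^sub>i\<close> is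
  closed, so the exceptional null set is empty (lemma \<open>abs_continuous_ae_mem_imp_mem\<close>).

  The equilibrium is read off from the optimality conditions of the allocation problem. Separating
  the origin from the set of all pairs (resource imbalance, anything above the excess cost) and
  using the Slater point to exclude a vertical hyperplane gives one vector \<open>\<mu>\<close> such that each
  \<open>x\<^sub>i\<^sup>*\<close> minimizes \<open>f\<^sub>i(y) - \<mu> \<bullet> y\<close> over \<open>\<Omega>\<^sub>i\<close> (lemma \<open>lagrange_multiplier\<close>).
  Hence \<open>- \<nabla>f\<^sub>i(x\<^sub>i\<^sup>*) + \<mu>\<close> lies in the normal cone of \<open>\<Omega>\<^sub>i\<close> at \<open>x\<^sub>i\<^sup>*\<close>, and the
  differentiated projection of it is \<open>0\<close>. Giving every agent the same multiplier \<open>\<mu>\<close> makes the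
  consensus terms in the \<open>\<lambda>\<close>s vanish, and it remains to choose \<open>Z\<close> with
  \<open>\<Sum>\<^sub>j (z\<^sub>i - z\<^sub>j) = d\<^sub>i - x\<^sub>i\<^sup>*\<close>. This is a Laplacian system on a connected graph whose
  right-hand side sums to zero, so it is solvable (lemma \<open>laplacian_solvable\<close>). Finally,
  positive definite Hessians make the objective strictly convex, so the optimal solution is unique.
\<close>

section \<open>Invariance of the constraint sets\<close>

text \<open>
  Multiplying the convergent quotient by \<open>\<delta>\<close> shows that the projection of \<open>x + \<delta> v\<close> tends to \<open>x\<close>;
  by continuity of the projection it also tends to the projection of \<open>x\<close>.
\<close>

lemma has_diff_proj_imp_mem:
  assumes "closed S" "convex S" "S \<noteq> {}" "has_diff_proj S x v w"
  shows "x \<in> S"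
proof -
  have ident: "((\<lambda>\<delta>::real. \<delta>) \<longlongrightarrow> 0) (at_right 0)"
    by (rule tendsto_ident_at)
  have "((\<lambda>\<delta>. \<delta> *\<^sub>R ((closest_point S (x + \<delta> *\<^sub>R v) - x) /\<^sub>R \<delta>)) \<longlongrightarrow> 0 *\<^sub>R w) (at_right 0)"
    using assms(4) unfolding has_diff_proj_def by (intro tendsto_scaleR ident)
  moreover have "\<forall>\<^sub>F \<delta> in at_right (0::real).
      \<delta> *\<^sub>R ((closest_point S (x + \<delta> *\<^sub>R v) - x) /\<^sub>R \<delta>) = closest_point S (x + \<delta> *\<^sub>R v) - x"
    by (auto simp: eventually_at_filter)
  ultimately have to_0: "((\<lambda>\<delta>. closest_point S (x + \<delta> *\<^sub>R v) - x) \<longlongrightarrow> 0) (at_right 0)"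
    by (simp add: tendsto_cong)
  have "((\<lambda>\<delta>. x + \<delta> *\<^sub>R v) \<longlongrightarrow> x + 0 *\<^sub>R v) (at_right 0)"
    by (intro tendsto_intros ident)
  then have "((\<lambda>\<delta>. closest_point S (x + \<delta> *\<^sub>R v)) \<longlongrightarrow> closest_point S x) (at_right 0)"
    using continuous_at_closest_point[OF assms(2,1,3)]
    by (intro isCont_tendsto_compose[where g = "closest_point S"]) auto
  then have "((\<lambda>\<delta>. closest_point S (x + \<delta> *\<^sub>R v) - x) \<longlongrightarrow> closest_point S x - x) (at_right 0)"
    by (intro tendsto_intros)
  then have "closest_point S x - x = 0"
    using to_0 tendsto_unique trivial_limit_at_right_real by blast
  then show ?thesis
    using closest_point_in_set[OF assms(1,3), of x] by simp
qed

lemma abs_continuous_on_imp_continuous_on: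
  fixes u :: "real \<Rightarrow> 'a::metric_space"
  assumes "abs_continuous_on S u" "is_interval S"
  shows "continuous_on S u"
  unfolding continuous_on_iff
proof (intro ballI allI impI)
  fix s e :: real
  assume s: "s \<in> S" and "0 < e"
  then have "\<exists>k>0. \<forall>D :: (real \<times> real) set.
     finite D \<and> (\<forall>(a, b)\<in>D. a < b \<and> {a..b} \<subseteq> S) \<and>
     pairwise (\<lambda>(a, b) (a', b'). {a<..<b} \<inter> {a'<..<b'} = {}) D \<and>
     (\<Sum>(a, b)\<in>D. b - a) < k \<longrightarrow> (\<Sum>(a, b)\<in>D. dist (u a) (u b)) < e"
    using assms(1) unfolding abs_continuous_on_def by simp
  then obtain k where "0 < k" and k: "\<forall>D :: (real \<times> real) set.
     finite D \<and> (\<forall>(a, b)\<in>D. a < b \<and> {a..b} \<subseteq> S) \<and>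
     pairwise (\<lambda>(a, b) (a', b'). {a<..<b} \<inter> {a'<..<b'} = {}) D \<and>
     (\<Sum>(a, b)\<in>D. b - a) < k \<longrightarrow> (\<Sum>(a, b)\<in>D. dist (u a) (u b)) < e"
    by (elim exE conjE)
  have step: "dist (u a) (u b) < e" if "a < b" "a \<in> S" "b \<in> S" "b - a < k" for a b
  proof -
    have "{a..b} \<subseteq> S"
      using mem_is_interval_1_I[OF assms(2) that(2,3)] by auto
    then show ?thesis
      using spec[OF k, of "{(a, b)}"] that by simp
  qed
  show "\<exists>k>0. \<forall>t\<in>S. dist t s < k \<longrightarrow> dist (u t) (u s) < e"
  proof (intro exI[of _ k] conjI ballI impI)
    fix t assume t: "t \<in> S" "dist t s < k"
    consider "t < s" | "t = s" | "s < t" by linarith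
    then show "dist (u t) (u s) < e"
      using step[of s t] step[of t s] s t \<open>0 < e\<close>
      by cases (auto simp: dist_real_def dist_commute)
  qed fact
qed

lemma abs_continuous_ae_mem_imp_mem:
  fixes u :: "real \<Rightarrow> 'a::metric_space"
  assumes ac: "\<And>T. 0 \<le> T \<Longrightarrow> abs_continuous_on {0..T} u"
    and "closed S" "u 0 \<in> S"
    and ae: "AE t in lebesgue. 0 \<le> t \<longrightarrow> u t \<in> S"
    and "0 \<le> t"
  shows "u t \<in> S"
proof -
  define T where "T = t + 1"
  have "0 \<le> T" "t < T"
    using \<open>0 \<le> t\<close> by (auto simp: T_def)
  \<comment> \<open>Clamping the time to \<open>[0, T]\<close> yields a continuous function on the whole line; for negative
     times it takes the value \<open>u 0\<close>, so almost everywhere on the open set \<open>{..<T}\<close> it is in \<open>S\<close>.\<close>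
  define v where "v s = u (max 0 (min s T))" for s
  have "continuous_on {0..T} u"
    using ac \<open>0 \<le> T\<close> by (intro abs_continuous_on_imp_continuous_on is_interval_cc)
  then have "continuous_on UNIV v"
    unfolding v_def
    by (rule continuous_on_compose2) (use \<open>0 \<le> T\<close> in \<open>auto intro!: continuous_intros\<close>)
  then have "closed (v -` S)"
    using \<open>closed S\<close> by (simp add: closed_vimage)
  moreover have "AE s \<in> {..<T} in lebesgue. s \<in> v -` S"
    using ae
  proof eventually_elim
    case (elim s)
    then show ?case
      using \<open>u 0 \<in> S\<close> by (cases "0 \<le> s") (auto simp: v_def max_def min_def)
  qed
  ultimately have "t \<in> v -` S"
    using \<open>t < T\<close> mem_closed_if_AE_lebesgue_open[of "{..<T}" "v -` S" t] by simp
  then show ?thesis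
    using \<open>0 \<le> t\<close> \<open>t < T\<close> by (simp add: v_def)
qed

lemma caratheodory_solution_invariant:
  assumes "closed (\<Omega> i)" "convex (\<Omega> i)"
    and sol: "caratheodory_solution f \<Omega> d G x l z"
    and "x i 0 \<in> \<Omega> i" "0 \<le> t"
  shows "x i t \<in> \<Omega> i"
proof (rule abs_continuous_ae_mem_imp_mem[where u = "x i"])
  show "abs_continuous_on {0..T} (x i)" if "0 \<le> T" for T
    using sol that unfolding caratheodory_solution_def by simp
  have "AE t in lebesgue. 0 \<le> t \<longrightarrow> (\<exists>x' l' z'.
      (\<forall>i. (x i has_vector_derivative x' i) (at t within {0..}) \<and>
           (l i has_vector_derivative l' i) (at t within {0..}) \<and>
           (z i has_vector_derivative z' i) (at t within {0..})) \<and>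
      is_rhs f \<Omega> d G (\<lambda>i. x i t) (\<lambda>i. l i t) (\<lambda>i. z i t) x' l' z')"
    using sol unfolding caratheodory_solution_def by (rule conjunct2)
  then show "AE t in lebesgue. 0 \<le> t \<longrightarrow> x i t \<in> \<Omega> i"
  proof eventually_elim
    case (elim t)
    show ?case
    proof
      assume "0 \<le> t"
      with elim obtain x' l' z'
        where "is_rhs f \<Omega> d G (\<lambda>i. x i t) (\<lambda>i. l i t) (\<lambda>i. z i t) x' l' z'"
        by (elim impE exE conjE)
      then have "has_diff_proj (\<Omega> i) (x i t) (- gradient (f i) (x i t) + l i t) (x' i)"
        unfolding is_rhs_def by simp
      moreover have "\<Omega> i \<noteq> {}"
        using \<open>x i 0 \<in> \<Omega> i\<close> by blast
      ultimately show "x i t \<in> \<Omega> i"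
        by (intro has_diff_proj_imp_mem[OF assms(1,2)])
    qed
  qed
  show "closed (\<Omega> i)" "x i 0 \<in> \<Omega> i" "0 \<le> t"
    by fact+
qed

section \<open>Gradients and strict convexity\<close>

lemma differentiable_imp_GDERIV_gradient:
  fixes f :: "'a::euclidean_space \<Rightarrow> real"
  assumes "f differentiable (at x)"
  shows "GDERIV f x :> gradient f x"
proof -
  obtain f' where f': "(f has_derivative f') (at x)"
    using assms unfolding differentiable_def by blast
  then have "linear f'"
    by (rule has_derivative_linear)
  \<comment> \<open>The adjoint of a linear functional at \<open>1\<close> is the vector that represents the functional.\<close>
  then have "f' = (\<lambda>h. h \<bullet> adjoint f' 1)"
    by (simp add: fun_eq_iff adjoint_works)
  then have ex: "GDERIV f x :> adjoint f' 1"
    using f' unfolding gderiv_def by simp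
  have "D = E" if "GDERIV f x :> D" "GDERIV f x :> E" for D E
  proof -
    have "(\<lambda>h. h \<bullet> D) = (\<lambda>h. h \<bullet> E)"
      using that unfolding gderiv_def by (rule has_derivative_unique)
    then show ?thesis
      by (metis vector_eq_rdot inner_commute vector_eq_ldot)
  qed
  then have "gradient f x = adjoint f' 1"
    unfolding gradient_def using ex by (intro the_equality)
  then show ?thesis
    using ex by simp
qed

lemma GDERIV_along_line:
  assumes "GDERIV g (x + t *\<^sub>R h) :> D"
  shows "((\<lambda>t. g (x + t *\<^sub>R h)) has_real_derivative h \<bullet> D) (at t)"
proof -
  have "((\<lambda>t. x + t *\<^sub>R h) has_derivative (\<lambda>s. s *\<^sub>R h)) (at t)"
    by (auto intro!: derivative_eq_intros)
  from has_derivative_compose[OF this] assms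
  have "((\<lambda>t. g (x + t *\<^sub>R h)) has_derivative (\<lambda>s. (s *\<^sub>R h) \<bullet> D)) (at t)"
    unfolding gderiv_def by blast
  then show ?thesis
    by (simp add: has_field_derivative_def mult.commute[of "h \<bullet> D"] fun_eq_iff mult_commute_abs)
qed

text \<open>
  Along the segment from \<open>x\<close> to \<open>y\<close> the slope of \<open>f\<close> has the derivative \<open>h \<bullet> H h > 0\<close>, so its mean
  over the first half of the segment is smaller than its mean over the second half.
\<close>

lemma smooth_convex_objective_midpoint_less:
  assumes f: "smooth_convex_objective f" and "x \<noteq> y"
  shows "f ((1/2) *\<^sub>R (x + y)) < (f x + f y) / 2"
proof -
  define h where "h = y - x"
  have "h \<noteq> 0"
    using \<open>x \<noteq> y\<close> by (simp add: h_def)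
  define \<phi> where "\<phi> t = f (x + t *\<^sub>R h)" for t
  define \<psi> where "\<psi> t = h \<bullet> gradient f (x + t *\<^sub>R h)" for t
  have \<phi>: "(\<phi> has_real_derivative \<psi> t) (at t)" for t
    unfolding \<phi>_def \<psi>_def using f
    by (intro GDERIV_along_line differentiable_imp_GDERIV_gradient)
      (simp add: smooth_convex_objective_def)
  have \<psi>: "\<exists>D. (\<psi> has_real_derivative D) (at t) \<and> 0 < D" for t
  proof -
    obtain H where "has_hessian f H (x + t *\<^sub>R h)" "positive_definite H"
      using f unfolding smooth_convex_objective_def by blast
    then have H: "(gradient f has_derivative (\<lambda>k. H *v k)) (at (x + t *\<^sub>R h))"
        "0 < h \<bullet> (H *v h)"
      using \<open>h \<noteq> 0\<close> by (auto simp: has_hessian_def positive_definite_def)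
    have "((\<lambda>t. x + t *\<^sub>R h) has_derivative (\<lambda>s. s *\<^sub>R h)) (at t)"
      by (auto intro!: derivative_eq_intros)
    from has_derivative_compose[OF this H(1)]
    have "((\<lambda>t. gradient f (x + t *\<^sub>R h)) has_derivative (\<lambda>s. s *\<^sub>R (H *v h))) (at t)"
      by (simp add: matrix_vector_mult_scaleR)
    then have "(\<psi> has_derivative (\<lambda>s. h \<bullet> (s *\<^sub>R (H *v h)))) (at t)"
      unfolding \<psi>_def by (intro has_derivative_inner_right)
    then have "(\<psi> has_real_derivative (h \<bullet> (H *v h))) (at t)"
      by (simp add: has_field_derivative_def mult_commute_abs)
    then show ?thesis
      using H(2) by blast
  qed
  have mvt: "\<exists>s>a. s < b \<and> \<phi> b - \<phi> a = (b - a) * \<psi> s" if "a < b" for a b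
    using MVT2[OF that, of \<phi> \<psi>] \<phi> by blast
  obtain s\<^sub>1 where s1: "s\<^sub>1 < 1/2" "\<phi> (1/2) - \<phi> 0 = (1/2 - 0) * \<psi> s\<^sub>1"
    using mvt[of 0 "1/2"] by auto
  obtain s\<^sub>2 where s2: "1/2 < s\<^sub>2" "\<phi> 1 - \<phi> (1/2) = (1 - 1/2) * \<psi> s\<^sub>2"
    using mvt[of "1/2" 1] by auto
  have "\<psi> s\<^sub>1 < \<psi> s\<^sub>2"
    using s1(1) s2(1) \<psi> by (intro DERIV_pos_imp_increasing[of s\<^sub>1 s\<^sub>2 \<psi>]) auto
  then have "2 * \<phi> (1/2) < \<phi> 0 + \<phi> 1"
    using s1(2) s2(2) by simp
  moreover have "\<phi> 0 = f x" "\<phi> 1 = f y"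
    by (simp_all add: \<phi>_def h_def)
  moreover have "x + (1/2) *\<^sub>R h = (1/2) *\<^sub>R (x + y)"
    by (simp add: h_def vec_eq_iff field_simps)
  then have "\<phi> (1/2) = f ((1/2) *\<^sub>R (x + y))"
    by (simp add: \<phi>_def)
  ultimately show ?thesis
    by simp
qed

text \<open>
  The midpoint of two different optimal solutions would be feasible and strictly cheaper.
\<close>

lemma optimal_solution_unique:
  assumes conv: "\<And>i. convex (\<Omega> i)" and f: "\<And>i. smooth_convex_objective (f i)"
    and X: "optimal_solution f \<Omega> d X" and Y: "optimal_solution f \<Omega> d Y"
  shows "Y = X"
proof (rule ccontr)
  assume "Y \<noteq> X"
  then obtain k where k: "X k \<noteq> Y k"
    by fastforce
  define F where "F W = (\<Sum>i\<in>UNIV. f i (W i))" for W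
  have X': "feasible \<Omega> d X" "\<And>W. feasible \<Omega> d W \<Longrightarrow> F X \<le> F W"
    and Y': "feasible \<Omega> d Y" "\<And>W. feasible \<Omega> d W \<Longrightarrow> F Y \<le> F W"
    using X Y unfolding optimal_solution_def is_arg_min_linorder F_def by auto
  define M where "M i = (1/2) *\<^sub>R (X i + Y i)" for i
  have "M i \<in> \<Omega> i" for i
    using convexD[OF conv, of "X i" i "Y i" "1/2" "1/2"] X'(1) Y'(1)
    by (simp add: M_def feasible_def scaleR_add_right)
  moreover have "(\<Sum>i\<in>UNIV. M i) = (\<Sum>i\<in>UNIV. d i)"
    using X'(1) Y'(1) unfolding M_def feasible_def
    by (simp add: scaleR_sum_right[symmetric] sum.distrib scaleR_2[symmetric])
  ultimately have "F X \<le> F M"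
    using X'(2) by (simp add: feasible_def)
  moreover have "F M < (\<Sum>i\<in>UNIV. (f i (X i) + f i (Y i)) / 2)"
    unfolding F_def
  proof (rule sum_strict_mono_ex1)
    show "\<forall>i\<in>UNIV. f i (M i) \<le> (f i (X i) + f i (Y i)) / 2"
    proof
      fix i
      show "f i (M i) \<le> (f i (X i) + f i (Y i)) / 2"
        using smooth_convex_objective_midpoint_less[OF f, of "X i" "Y i" i]
        by (cases "X i = Y i") (auto simp: M_def scaleR_2[symmetric])
    qed
    show "\<exists>i\<in>UNIV. f i (M i) < (f i (X i) + f i (Y i)) / 2"
      using smooth_convex_objective_midpoint_less[OF f k] by (auto simp: M_def)
  qed simp
  moreover have "(\<Sum>i\<in>UNIV. (f i (X i) + f i (Y i)) / 2) = (F X + F Y) / 2"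
    by (simp add: F_def sum.distrib sum_divide_distrib[symmetric])
  moreover have "F Y \<le> F X"
    using X'(1) Y'(2) by blast
  ultimately show False
    by simp
qed

section \<open>Optimality conditions\<close>

text \<open>
  Strong duality for the resource constraint. In the separating functional \<open>(\<nu>, s)\<close> the component
  \<open>s\<close> is nonnegative, because it is paired with costs that can be raised freely. If it were \<open>0\<close>,
  moving one agent from the Slater point a little in the direction \<open>- \<nu>\<close> would give
  \<open>- \<nu> \<bullet> \<nu> \<ge> 0\<close>, so the functional would vanish. Hence \<open>s > 0\<close>, and \<open>\<mu> = - \<nu> / s\<close>
  is a multiplier: varying one agent at a time localizes the inequality.
\<close>

lemma lagrange_multiplier:
  fixes f :: "'n::finite \<Rightarrow> real ^ 'm \<Rightarrow> real"
  assumes conv: "\<And>i. convex (\<Omega> i)" and f: "\<And>i. convex_on (\<Omega> i) (f i)"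
    and X: "optimal_solution f \<Omega> d X" and slater: "slater_condition \<Omega> d"
  obtains \<mu> where "\<And>i y. y \<in> \<Omega> i \<Longrightarrow> f i (X i) - \<mu> \<bullet> X i \<le> f i y - \<mu> \<bullet> y"
proof -
  have X\<Omega>: "\<And>i. X i \<in> \<Omega> i" and sumX: "(\<Sum>i\<in>UNIV. X i) = (\<Sum>i\<in>UNIV. d i)"
    and opt: "\<And>W. feasible \<Omega> d W \<Longrightarrow> (\<Sum>i\<in>UNIV. f i (X i)) \<le> (\<Sum>i\<in>UNIV. f i (W i))"
    using X unfolding optimal_solution_def is_arg_min_linorder feasible_def by auto
  define C where "C = {(a, r) | a r Y. (\<forall>i. Y i \<in> \<Omega> i) \<and> a = (\<Sum>i\<in>UNIV. Y i) - (\<Sum>i\<in>UNIV. d i)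
      \<and> (\<Sum>i\<in>UNIV. f i (Y i)) - (\<Sum>i\<in>UNIV. f i (X i)) < (r::real)}"
  have "convex C"
  proof (rule convexI)
    fix p q and u v :: real
    assume "p \<in> C" "q \<in> C" and uv: "0 \<le> u" "0 \<le> v" "u + v = 1"
    then obtain a r Y b s W where p: "p = (a, r)" "\<And>i. Y i \<in> \<Omega> i"
        "a = (\<Sum>i\<in>UNIV. Y i) - (\<Sum>i\<in>UNIV. d i)"
        "(\<Sum>i\<in>UNIV. f i (Y i)) - (\<Sum>i\<in>UNIV. f i (X i)) < r"
      and q: "q = (b, s)" "\<And>i. W i \<in> \<Omega> i"
        "b = (\<Sum>i\<in>UNIV. W i) - (\<Sum>i\<in>UNIV. d i)"
        "(\<Sum>i\<in>UNIV. f i (W i)) - (\<Sum>i\<in>UNIV. f i (X i)) < s"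
      unfolding C_def by blast
    define V where "V i = u *\<^sub>R Y i + v *\<^sub>R W i" for i
    have "V i \<in> \<Omega> i" for i
      unfolding V_def using convexD[OF conv] p q uv by blast
    moreover have "u *\<^sub>R a + v *\<^sub>R b = (\<Sum>i\<in>UNIV. V i) - (u + v) *\<^sub>R (\<Sum>i\<in>UNIV. d i)"
      by (simp add: p q V_def sum.distrib scaleR_sum_right algebra_simps)
    moreover have "(\<Sum>i\<in>UNIV. f i (V i)) - (\<Sum>i\<in>UNIV. f i (X i)) < u * r + v * s"
    proof -
      have "f i (V i) \<le> u * f i (Y i) + v * f i (W i)" for i
        using f[of i] p(2)[of i] q(2)[of i] uv unfolding convex_on_def V_def by blast
      then have "(\<Sum>i\<in>UNIV. f i (V i)) \<le> (\<Sum>i\<in>UNIV. u * f i (Y i) + v * f i (W i))"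
        by (intro sum_mono)
      then have "(\<Sum>i\<in>UNIV. f i (V i)) - (\<Sum>i\<in>UNIV. f i (X i))
          \<le> u * (\<Sum>i\<in>UNIV. f i (Y i)) + v * (\<Sum>i\<in>UNIV. f i (W i))
            - (u + v) * (\<Sum>i\<in>UNIV. f i (X i))"
        using uv(3) by (simp add: sum.distrib sum_distrib_left)
      also have "\<dots> = u * ((\<Sum>i\<in>UNIV. f i (Y i)) - (\<Sum>i\<in>UNIV. f i (X i)))
          + v * ((\<Sum>i\<in>UNIV. f i (W i)) - (\<Sum>i\<in>UNIV. f i (X i)))"
        by (simp add: algebra_simps)
      also have "\<dots> < u * r + v * s"
      proof (cases "u = 0")
        case True
        then show ?thesis
          using q(4) uv by simp
      next
        case False
        then show ?thesis
          using p(4) q(4) uv by (intro add_less_le_mono mult_strict_left_mono mult_left_mono) auto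
      qed
      finally show ?thesis .
    qed
    ultimately show "u *\<^sub>R p + v *\<^sub>R q \<in> C"
      unfolding C_def using uv(3) by (auto simp: p(1) q(1) intro!: exI[of _ V])
  qed
  moreover have "0 \<notin> C"
    using opt unfolding C_def feasible_def zero_prod_def by force
  ultimately obtain c where "c \<noteq> 0" "\<forall>p\<in>C. 0 \<le> c \<bullet> p"
    using separating_hyperplane_set_0 by blast
  moreover obtain \<nu> s where "c = (\<nu>, s)"
    by (cases c)
  ultimately have \<nu>s: "(\<nu>, s) \<noteq> 0" and sep: "\<And>p. p \<in> C \<Longrightarrow> 0 \<le> (\<nu>, s) \<bullet> p"
    by auto
  have sepC: "0 \<le> \<nu> \<bullet> ((\<Sum>i\<in>UNIV. Y i) - (\<Sum>i\<in>UNIV. d i)) + s * r"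
    if "\<And>i. Y i \<in> \<Omega> i" "(\<Sum>i\<in>UNIV. f i (Y i)) - (\<Sum>i\<in>UNIV. f i (X i)) < r" for Y r
    using sep[of "((\<Sum>i\<in>UNIV. Y i) - (\<Sum>i\<in>UNIV. d i), r)"] that
    by (auto simp: C_def inner_prod_def)
  have "0 \<le> s"
    using sepC[of X 1] X\<Omega> sumX by simp
  moreover have "s \<noteq> 0"
  proof
    assume "s = 0"
    then have "\<nu> \<noteq> 0"
      using \<nu>s by (auto simp: zero_prod_def)
    obtain Y where Y: "\<And>i. Y i \<in> interior (\<Omega> i)" "(\<Sum>i\<in>UNIV. Y i) = (\<Sum>i\<in>UNIV. d i)"
      using slater unfolding slater_condition_def by blast
    \<comment> \<open>Any agent will do.\<close>
    define k :: 'n where "k = undefined"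
    obtain e where e: "0 < e" "ball (Y k) e \<subseteq> \<Omega> k"
      using Y(1)[of k] unfolding mem_interior by blast
    define w where "w = (e / (2 * norm \<nu>)) *\<^sub>R \<nu>"
    have "Y k - w \<in> \<Omega> k"
      using e \<open>\<nu> \<noteq> 0\<close> by (auto simp: w_def dist_norm intro!: subsetD[OF e(2)])
    then have W: "(Y(k := Y k - w)) i \<in> \<Omega> i" for i
      using Y(1)[of i] interior_subset by auto
    have "(\<Sum>i\<in>UNIV. (Y(k := Y k - w)) i) = (\<Sum>i\<in>UNIV. Y i - (if i = k then w else 0))"
      by (intro sum.cong) auto
    also have "\<dots> = (\<Sum>i\<in>UNIV. d i) - w"
      by (simp add: sum_subtractf Y(2))
    finally have "0 \<le> \<nu> \<bullet> (- w)"
      using sepC[OF W less_add_one] \<open>s = 0\<close> by simp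
    moreover have "0 < \<nu> \<bullet> w"
      using e(1) \<open>\<nu> \<noteq> 0\<close> by (simp add: w_def)
    ultimately show False
      by simp
  qed
  ultimately have "0 < s"
    by simp
  \<comment> \<open>All points above the graph satisfy the separation, hence so do the points on it.\<close>
  have graph: "0 \<le> \<nu> \<bullet> ((\<Sum>i\<in>UNIV. Y i) - (\<Sum>i\<in>UNIV. d i))
      + s * ((\<Sum>i\<in>UNIV. f i (Y i)) - (\<Sum>i\<in>UNIV. f i (X i)))"
    (is "0 \<le> ?a + s * ?r") if "\<And>i. Y i \<in> \<Omega> i" for Y
  proof (rule field_le_epsilon)
    fix e :: real assume "0 < e"
    then show "0 \<le> ?a + s * ?r + e"
      using sepC[of Y "?r + e / s"] that \<open>0 < s\<close> by (simp add: distrib_left)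
  qed
  show ?thesis
  proof (rule that[of "- (\<nu> /\<^sub>R s)"])
    fix i y assume y: "y \<in> \<Omega> i"
    define Y where "Y = X(i := y)"
    have Y: "Y j = X j + (if j = i then y - X i else 0)"
        "f j (Y j) = f j (X j) + (if j = i then f i y - f i (X i) else 0)" for j
      by (auto simp: Y_def)
    have "0 \<le> \<nu> \<bullet> (y - X i) + s * (f i y - f i (X i))"
      using graph[of Y] y X\<Omega> sumX unfolding Y(2)
      by (simp add: Y(1) sum.distrib)
    then have "0 \<le> (\<nu> \<bullet> (y - X i) + s * (f i y - f i (X i))) / s"
      using \<open>0 < s\<close> by simp
    also have "\<dots> = (\<nu> /\<^sub>R s) \<bullet> (y - X i) + (f i y - f i (X i))"
      using \<open>0 < s\<close> by (simp add: field_simps)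
    finally show "f i (X i) - (- (\<nu> /\<^sub>R s)) \<bullet> X i \<le> f i y - (- (\<nu> /\<^sub>R s)) \<bullet> y"
      by (simp add: inner_diff_right[of "\<nu> /\<^sub>R s"] del: inner_scaleR_left)
  qed
qed

lemma minimum_on_convex_imp_gradient_inner_nonneg:
  assumes "convex S" "x \<in> S" "y \<in> S" and D: "GDERIV g x :> D"
    and min: "\<And>z. z \<in> S \<Longrightarrow> g x \<le> g z"
  shows "0 \<le> (y - x) \<bullet> D"
proof (rule ccontr)
  assume "\<not> 0 \<le> (y - x) \<bullet> D"
  moreover have "((\<lambda>t. g (x + t *\<^sub>R (y - x))) has_real_derivative (y - x) \<bullet> D) (at 0)"
    using D by (intro GDERIV_along_line) simp
  ultimately obtain e where "0 < e"
    and e: "\<And>h. 0 < h \<Longrightarrow> h < e \<Longrightarrow> g (x + h *\<^sub>R (y - x)) < g x"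
    using DERIV_neg_dec_right[of "\<lambda>t. g (x + t *\<^sub>R (y - x))" "(y - x) \<bullet> D" 0] by auto
  define h where "h = min 1 (e / 2)"
  have h: "0 < h" "h < e" "h \<le> 1"
    using \<open>0 < e\<close> by (auto simp: h_def)
  have "(1 - h) *\<^sub>R x + h *\<^sub>R y \<in> S"
    using assms(1-3) h by (intro convexD) auto
  then have "x + h *\<^sub>R (y - x) \<in> S"
    by (simp add: algebra_simps)
  then show False
    using min e h by force
qed

text \<open>
  If \<open>v\<close> lies in the normal cone of \<open>S\<close> at \<open>x\<close>, then \<open>x\<close> is the projection of every \<open>x + \<delta> v\<close> with
  \<open>\<delta> \<ge> 0\<close>, so the quotients are identically zero.
\<close>

lemma has_diff_proj_normal:
  assumes "closed S" "convex S" "x \<in> S" and normal: "\<And>y. y \<in> S \<Longrightarrow> (y - x) \<bullet> v \<le> 0"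
  shows "has_diff_proj S x v 0"
proof -
  have "closest_point S (x + \<delta> *\<^sub>R v) = x" if "0 < \<delta>" for \<delta>
  proof (rule closest_point_unique[symmetric])
    show "\<forall>y\<in>S. dist (x + \<delta> *\<^sub>R v) x \<le> dist (x + \<delta> *\<^sub>R v) y"
    proof
      fix y assume "y \<in> S"
      define w where "w = y - x"
      have "\<delta> * (w \<bullet> v) \<le> 0"
        using normal[OF \<open>y \<in> S\<close>] that by (simp add: w_def mult_nonneg_nonpos)
      moreover have "(\<delta> *\<^sub>R v - w) \<bullet> (\<delta> *\<^sub>R v - w)
          = (\<delta> *\<^sub>R v) \<bullet> (\<delta> *\<^sub>R v) - 2 * (\<delta> * (w \<bullet> v)) + w \<bullet> w"
        by (simp add: inner_diff_left inner_diff_right inner_commute)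
      ultimately have "(\<delta> *\<^sub>R v) \<bullet> (\<delta> *\<^sub>R v) \<le> (\<delta> *\<^sub>R v - w) \<bullet> (\<delta> *\<^sub>R v - w)"
        using inner_ge_zero[of w] by linarith
      then have "norm (\<delta> *\<^sub>R v) \<le> norm (\<delta> *\<^sub>R v - w)"
        unfolding norm_le .
      moreover have "x + \<delta> *\<^sub>R v - x = \<delta> *\<^sub>R v" "x + \<delta> *\<^sub>R v - y = \<delta> *\<^sub>R v - w"
        by (simp_all add: w_def)
      ultimately show "dist (x + \<delta> *\<^sub>R v) x \<le> dist (x + \<delta> *\<^sub>R v) y"
        unfolding dist_norm by metis
    qed
  qed fact+
  then have "\<forall>\<^sub>F \<delta> in at_right 0. (closest_point S (x + \<delta> *\<^sub>R v) - x) /\<^sub>R \<delta> = 0"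
    by (auto simp: eventually_at_filter)
  then show ?thesis
    unfolding has_diff_proj_def by (rule tendsto_eventually)
qed

section \<open>The graph Laplacian\<close>

lemma constant_on_arcs_imp_constant:
  assumes G: "undirected_connected_graph G" and arcs: "\<And>i j. (i, j) \<in> parcs G \<Longrightarrow> r i = r j"
  shows "r i = r j"
proof -
  have "i \<rightarrow>\<^sup>*\<^bsub>with_proj (mk_symmetric (with_proj G))\<^esub> j"
    using G unfolding undirected_connected_graph_def connected_def strongly_connected_def by simp
  from reachable_rtranclI[OF this] show ?thesis
  proof (induction rule: rtrancl_induct)
    case (step x y)
    then show ?case
      using arcs by (auto simp: parcs_mk_symmetric)
  qed simp
qed

lemma neighbors_sym:
  assumes "undirected_connected_graph G"
  shows "j \<in> neighbors G i \<longleftrightarrow> i \<in> neighbors G j"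
proof -
  interpret pair_sym_digraph G
    using assms unfolding undirected_connected_graph_def by blast
  show ?thesis
    using graph_symmetric unfolding neighbors_def by auto
qed

text \<open>
  Split \<open>b\<close> into a vector in the range of the Laplacian and a vector \<open>r\<close> orthogonal to the range.
  The inner product of \<open>r\<close> with its own image is half of \<open>\<Sum> \<parallel>r\<^sub>i - r\<^sub>j\<parallel>\<^sup>2\<close> over the arcs, so \<open>r\<close> is
  constant; as \<open>b\<close> sums to zero, \<open>r \<bullet> r = r \<bullet> b = 0\<close>.
\<close>

lemma laplacian_solvable:
  fixes b :: "'n::finite \<Rightarrow> 'a::euclidean_space"
  assumes G: "undirected_connected_graph G" and b: "(\<Sum>i\<in>UNIV. b i) = 0"
  obtains z where "\<And>i. (\<Sum>j\<in>neighbors G i. z i - z j) = b i"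
proof -
  define A :: "'a ^ 'n \<Rightarrow> 'a ^ 'n" where "A z = (\<chi> i. \<Sum>j\<in>neighbors G i. z $ i - z $ j)" for z
  have "linear A"
    by (rule linearI)
      (simp_all add: A_def vec_eq_iff sum.distrib[symmetric] scaleR_sum_right algebra_simps)
  then have "subspace (range A)"
    by (intro linear_subspace_image subspace_UNIV)
  obtain y r where y: "y \<in> span (range A)"
    and r: "\<And>w. w \<in> span (range A) \<Longrightarrow> orthogonal r w" and split: "(\<chi> i. b i) = y + r"
    using orthogonal_subspace_decomp_exists[of "range A" "\<chi> i. b i"] by blast
  define N where "N i j = (if j \<in> neighbors G i then (1::real) else 0)" for i j
  have N: "N i j = N j i" for i j
    using neighbors_sym[OF G] by (auto simp: N_def)
  define q where "q i j = N i j * (r $ i \<bullet> (r $ i - r $ j))" for i j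
  have "0 = r \<bullet> A r"
    using r[of "A r"] by (simp add: orthogonal_def span_base)
  also have "\<dots> = (\<Sum>i\<in>UNIV. \<Sum>j\<in>UNIV. q i j)"
    by (simp add: inner_vec_def A_def inner_sum_right q_def N_def sum.If_cases
        if_distrib[of "\<lambda>c. c * _"] cong: if_cong)
  finally have q0: "(\<Sum>i\<in>UNIV. \<Sum>j\<in>UNIV. q i j) = 0"
    by simp
  moreover have "(\<Sum>i\<in>UNIV. \<Sum>j\<in>UNIV. q j i) = (\<Sum>i\<in>UNIV. \<Sum>j\<in>UNIV. q i j)"
    by (rule sum.swap)
  ultimately have "(\<Sum>i\<in>UNIV. \<Sum>j\<in>UNIV. q i j + q j i) = 0"
    by (simp add: sum.distrib)
  moreover have "q i j + q j i = N i j * ((r $ i - r $ j) \<bullet> (r $ i - r $ j))" for i j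
    by (simp add: q_def N[of j i] inner_diff_left inner_diff_right inner_commute algebra_simps)
  ultimately have "(\<Sum>i\<in>UNIV. \<Sum>j\<in>UNIV. N i j * ((r $ i - r $ j) \<bullet> (r $ i - r $ j))) = 0"
    by simp
  moreover have nonneg: "0 \<le> N i j * ((r $ i - r $ j) \<bullet> (r $ i - r $ j))" for i j
    by (simp add: N_def)
  ultimately have zero: "N i j * ((r $ i - r $ j) \<bullet> (r $ i - r $ j)) = 0" for i j
    by (simp add: sum_nonneg_eq_0_iff sum_nonneg)
  have const: "r $ i = r $ j" for i j
  proof (rule constant_on_arcs_imp_constant[OF G])
    fix i j assume "(i, j) \<in> parcs G"
    then show "r $ i = r $ j"
      using zero[of j i] by (simp add: N_def neighbors_def)
  qed
  have "r \<bullet> r = r \<bullet> (y + r)"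
    using r[OF y] by (simp add: orthogonal_def inner_add_right)
  also have "\<dots> = (\<Sum>i\<in>UNIV. r $ i \<bullet> b i)"
    unfolding split[symmetric] inner_vec_def by simp
  \<comment> \<open>The vertex \<open>undefined\<close> is an arbitrary one at which to read off the constant value of \<open>r\<close>.\<close>
  also have "\<dots> = (\<Sum>i\<in>UNIV. r $ undefined \<bullet> b i)"
    using const by (intro sum.cong) metis+
  also have "\<dots> = 0"
    by (simp add: inner_sum_right[symmetric] b)
  finally have "(\<chi> i. b i) \<in> range A"
    using y split \<open>subspace (range A)\<close> by (simp add: span_eq_iff[THEN iffD2])
  then obtain z where "A z = (\<chi> i. b i)"
    by auto
  then show ?thesis
    by (intro that[of "\<lambda>i. z $ i"]) (auto simp: A_def vec_eq_iff)
qed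

section \<open>Invariance and equilibrium of the projected algorithm\<close>

lemma optimal_solution_imp_equilibrium_point:
  fixes f :: "'n::finite \<Rightarrow> real ^ 'm \<Rightarrow> real"
  assumes closed: "\<And>i. closed (\<Omega> i)" and conv: "\<And>i. convex (\<Omega> i)"
    and f: "\<And>i. smooth_convex_objective (f i)"
    and X: "optimal_solution f \<Omega> d X" and slater: "slater_condition \<Omega> d"
    and G: "undirected_connected_graph G"
  shows "\<exists>L Z. equilibrium_point f \<Omega> d G X L Z"
proof -
  have X\<Omega>: "X i \<in> \<Omega> i" and sumX: "(\<Sum>i\<in>UNIV. X i) = (\<Sum>i\<in>UNIV. d i)" for i
    using X unfolding optimal_solution_def is_arg_min_def feasible_def by auto
  have "convex_on (\<Omega> i) (f i)" for i
    using f[of i] conv[of i] convex_on_subset unfolding smooth_convex_objective_def by blast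
  then obtain \<mu> where \<mu>: "\<And>i y. y \<in> \<Omega> i \<Longrightarrow> f i (X i) - \<mu> \<bullet> X i \<le> f i y - \<mu> \<bullet> y"
    using lagrange_multiplier[OF conv _ X slater] by blast
  have proj: "has_diff_proj (\<Omega> i) (X i) (- gradient (f i) (X i) + \<mu>) 0" for i
  proof (rule has_diff_proj_normal[OF closed conv X\<Omega>])
    fix y assume "y \<in> \<Omega> i"
    have "GDERIV (f i) (X i) :> gradient (f i) (X i)"
      using f[of i] by (intro differentiable_imp_GDERIV_gradient)
        (simp add: smooth_convex_objective_def)
    moreover have "GDERIV (\<lambda>y. \<mu> \<bullet> y) (X i) :> \<mu>"
      unfolding gderiv_def by (auto intro!: derivative_eq_intros simp: inner_commute)
    ultimately have "0 \<le> (y - X i) \<bullet> (gradient (f i) (X i) - \<mu>)"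
      using \<mu> X\<Omega> \<open>y \<in> \<Omega> i\<close>
      by (intro minimum_on_convex_imp_gradient_inner_nonneg[OF conv,
          where g = "\<lambda>y. f i y - \<mu> \<bullet> y"] GDERIV_diff) auto
    then show "(y - X i) \<bullet> (- gradient (f i) (X i) + \<mu>) \<le> 0"
      by (simp add: inner_diff_right inner_add_right)
  qed
  obtain Z where "\<And>i. (\<Sum>j\<in>neighbors G i. Z i - Z j) = d i - X i"
    using laplacian_solvable[OF G, of "\<lambda>i. d i - X i"] sumX by (auto simp: sum_subtractf)
  then have "equilibrium_point f \<Omega> d G X (\<lambda>_. \<mu>) Z"
    unfolding equilibrium_point_def is_rhs_def using X\<Omega> proj by simp
  then show ?thesis
    by blast
qed

theorem theorem4p2:
  fixes f :: "'n::finite \<Rightarrow> real ^ 'm \<Rightarrow> real"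
    and \<Omega> :: "'n \<Rightarrow> (real ^ 'm) set"
    and d :: "'n \<Rightarrow> real ^ 'm"
    and G :: "'n pair_pre_digraph"
  assumes "\<And>i. closed (\<Omega> i)" and "\<And>i. convex (\<Omega> i)"
    and "\<And>i. smooth_convex_objective (f i)"
    and "\<exists>X. optimal_solution f \<Omega> d X" and "slater_condition \<Omega> d"
    and "undirected_connected_graph G"
  shows "(\<forall>x l z. caratheodory_solution f \<Omega> d G x l z \<and> (\<forall>i. x i 0 \<in> \<Omega> i) \<longrightarrow>
            (\<forall>t\<ge>0. \<forall>i. x i t \<in> \<Omega> i)) \<and>
         (\<exists>X L Z. equilibrium_point f \<Omega> d G X L Z \<and>
            optimal_solution f \<Omega> d X \<and> (\<forall>Y. optimal_solution f \<Omega> d Y \<longrightarrow> Y = X))"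
proof
  show "\<forall>x l z. caratheodory_solution f \<Omega> d G x l z \<and> (\<forall>i. x i 0 \<in> \<Omega> i) \<longrightarrow>
      (\<forall>t\<ge>0. \<forall>i. x i t \<in> \<Omega> i)"
    using caratheodory_solution_invariant[where \<Omega> = \<Omega>, OF assms(1,2)] by blast
  show "\<exists>X L Z. equilibrium_point f \<Omega> d G X L Z \<and>
      optimal_solution f \<Omega> d X \<and> (\<forall>Y. optimal_solution f \<Omega> d Y \<longrightarrow> Y = X)"
    using optimal_solution_imp_equilibrium_point[where f = f and \<Omega> = \<Omega>, OF assms(1-3) _ assms(5,6)]
      optimal_solution_unique[where f = f and \<Omega> = \<Omega>, OF assms(2,3)] assms(4) by blast
qed

end
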